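(* Let $n\ge 1$ be an integer and let $\begin{bmatrix}A & B\\ B^* & C\end{bmatrix}\in\mathbb{M}_2(\mathbb{M}_n)$ be positive semidefinite. Then \[ \begin{bmatrix}(\mathrm{tr}\,A)I+C & (\mathrm{tr}\,B)I-B\\ (\mathrm{tr}\,B^* )I-B^* & (\mathrm{tr}\,C)I+A\end{bmatrix} \] is PPT.
   Context: $\mathbb{M}_n$ is the space of $n\times n$ complex matrices, and $\mathbb{M}_2(\mathbb{M}_n)$ is the set of $2\times 2$ block matrices with blocks in $\mathbb{M}_n$, regarded also as $2n\times 2n$ complex matrices. $I$ is the $n\times n$ identity matrix and $\mathrm{tr}$ is the usual trace. The partial transpose of $X=\begin{bmatrix} X_{1,1} & X_{1,2} \\ X_{2,1} & X_{2,2} \end{bmatrix}\in\mathbb{M}_2(\mathbb{M}_n)$ is $X^{\tau}=\begin{bmatrix} X_{1,1} & X_{2,1} \\ X_{1,2} & X_{2,2} \end{bmatrix}$ (the blocks themselves are not transposed). $X$ is PPT (positive partial transpose) if both $X$ and $X^\tau$ are positive semidefinite. *)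

theory Defs
  imports "Jordan_Normal_Form.Schur_Decomposition"
begin

definition mat_trace :: "complex mat \<Rightarrow> complex" where
  "mat_trace A = (\<Sum>i<dim_row A. A $$ (i, i))"

(* In the order of HOL-Library.Complex_Order, "0 \<le> z" says that the complex number z
   is real and nonnegative. *)
definition positive_semidefinite :: "complex mat \<Rightarrow> bool" where
  "positive_semidefinite A \<longleftrightarrow>
     square_mat A \<and> mat_adjoint A = A \<and>
     (\<forall>v \<in> carrier_vec (dim_row A). 0 \<le> (A *\<^sub>v v) \<bullet>c v)"

(* Elements of M_2(M_n) are 2n x 2n matrices; the parameter n is the block size.
   The off-diagonal blocks are swapped, without being transposed themselves. *)
definition partial_transpose :: "nat \<Rightarrow> complex mat \<Rightarrow> complex mat" where
  "partial_transpose n X =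
     (case split_block X n n of (X11, X12, X21, X22) \<Rightarrow> four_block_mat X11 X21 X12 X22)"

definition PPT :: "nat \<Rightarrow> complex mat \<Rightarrow> bool" where
  "PPT n X \<longleftrightarrow> X \<in> carrier_mat (2 * n) (2 * n) \<and>
     positive_semidefinite X \<and> positive_semidefinite (partial_transpose n X)"

lemma partial_transpose_four_block_mat:
  assumes "A \<in> carrier_mat n n" "B \<in> carrier_mat n n" "C \<in> carrier_mat n n" "D \<in> carrier_mat n n"
  shows "partial_transpose n (four_block_mat A B C D) = four_block_mat A C B D"
  using assms unfolding partial_transpose_def split_block_def Let_def
  by (intro eq_matI) auto

end

theory Submission
  imports Defs
begin

text \<open>
  Everything in the statement is linear in the given block matrix \<open>H\<close>, and a positive
  semidefinite \<open>H\<close> is a sum of rank-one matrices \<open>w w\<^sup>*\<close> (\<open>positive_semidefinite_gram\<close>).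
  Splitting \<open>w\<close> into halves \<open>a\<close> and \<open>b\<close>, it is enough to treat \<open>A = a a\<^sup>*\<close>, \<open>B = a b\<^sup>*\<close>,
  \<open>C = b b\<^sup>*\<close>. With \<open>\<langle>u, v\<rangle> = \<Sum>i. u i * cnj (v i)\<close>, the quadratic form of the new block
  matrix at \<open>(x, y)\<close> is then

  \<open>\<parallel>a\<parallel>\<^sup>2 \<parallel>x\<parallel>\<^sup>2 + \<parallel>b\<parallel>\<^sup>2 \<parallel>y\<parallel>\<^sup>2 + 2 Re (\<langle>a, b\<rangle> \<langle>y, x\<rangle>)
    + \<bar>\<langle>b, x\<rangle>\<bar>\<^sup>2 + \<bar>\<langle>a, y\<rangle>\<bar>\<^sup>2 - 2 Re (\<langle>a, x\<rangle> \<langle>y, b\<rangle>)\<close>.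

  The first three terms are the squared Hilbert-Schmidt norm of \<open>a x\<^sup>* + b y\<^sup>*\<close>. That matrix
  has rank at most two, so its squared norm is at least twice the product of its singular
  values, and this product dominates the modulus of the product of its two possibly nonzero
  eigenvalues, which is \<open>D = \<langle>a, x\<rangle> \<langle>b, y\<rangle> - \<langle>b, x\<rangle> \<langle>a, y\<rangle>\<close>. Since
  \<open>\<bar>\<langle>b, x\<rangle>\<bar>\<^sup>2 + \<bar>\<langle>a, y\<rangle>\<bar>\<^sup>2 \<ge> 2 \<bar>\<langle>b, x\<rangle> \<langle>a, y\<rangle>\<bar>\<close>, the negative term is absorbed by the
  triangle inequality. The bound by \<open>2 \<bar>D\<bar>\<close> is obtained without singular values: \<open>2 D\<close> is an
  inner product of two wedge products (the Cauchy-Binet identity), so Cauchy-Schwarz bounds it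
  by Gram determinants (\<open>Cauchy_Schwarz_wedge\<close>), and the rest is an inequality between real
  numbers (\<open>two_det_le\<close>).

  The partial transpose replaces \<open>a b\<^sup>*\<close> by \<open>b a\<^sup>*\<close>. Then the negative term becomes
  \<open>2 Re (\<langle>b, x\<rangle> \<langle>y, a\<rangle>)\<close>, which the two squared inner products absorb on their own.
\<close>

section \<open>Inner products and wedge products\<close>

text \<open>
  The index set is arbitrary because Cauchy-Schwarz is needed both for vectors and for their
  wedge products, whose coordinates are indexed by pairs.
\<close>

definition ip :: "'i set \<Rightarrow> ('i \<Rightarrow> complex) \<Rightarrow> ('i \<Rightarrow> complex) \<Rightarrow> complex" where
  "ip I u v = (\<Sum>i\<in>I. u i * cnj (v i))"

definition nsq :: "'i set \<Rightarrow> ('i \<Rightarrow> complex) \<Rightarrow> real" where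
  "nsq I u = (\<Sum>i\<in>I. (cmod (u i))\<^sup>2)"

lemma nsq_nonneg: "0 \<le> nsq I u"
  unfolding nsq_def by (simp add: sum_nonneg)

lemma ip_self: "ip I u u = of_real (nsq I u)"
  unfolding ip_def nsq_def by (simp add: complex_norm_square flip: of_real_power)

lemma cnj_ip: "cnj (ip I u v) = ip I v u"
  unfolding ip_def by (simp add: mult.commute)

lemma norm_ip_commute: "cmod (ip I u v) = cmod (ip I v u)"
  by (metis cnj_ip complex_mod_cnj)

definition wedge :: "('i \<Rightarrow> complex) \<Rightarrow> ('i \<Rightarrow> complex) \<Rightarrow> 'i \<times> 'i \<Rightarrow> complex" where
  "wedge a b = (\<lambda>(i, j). a i * b j - a j * b i)"

text \<open>
  The Cauchy-Binet identity. Summing over all ordered pairs counts every minor twice, which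
  gives the factor \<open>2\<close>.
\<close>

lemma ip_wedge:
  "ip (I \<times> I) (wedge a b) (wedge x y) = 2 * (ip I a x * ip I b y - ip I b x * ip I a y)"
proof -
  have prod: "(\<Sum>i\<in>I. \<Sum>j\<in>I. (f i * cnj (g i)) * (h j * cnj (k j))) = ip I f g * ip I h k"
    for f g h k :: "'a \<Rightarrow> complex"
    unfolding ip_def by (simp add: sum_product)
  have "ip (I \<times> I) (wedge a b) (wedge x y) =
      (\<Sum>i\<in>I. \<Sum>j\<in>I. (a i * cnj (x i)) * (b j * cnj (y j)) - (a i * cnj (y i)) * (b j * cnj (x j))
         - (b i * cnj (x i)) * (a j * cnj (y j)) + (b i * cnj (y i)) * (a j * cnj (x j)))"
    unfolding ip_def[of "I \<times> I"] wedge_def sum.cartesian_product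
    by (intro sum.cong refl) (auto simp: algebra_simps)
  also have "\<dots> = 2 * (ip I a x * ip I b y - ip I b x * ip I a y)"
    by (simp only: sum.distrib sum_subtractf prod) (simp add: algebra_simps)
  finally show ?thesis .
qed

lemma nsq_wedge:
  "nsq (I \<times> I) (wedge a b) = 2 * (nsq I a * nsq I b - (cmod (ip I a b))\<^sup>2)"
proof -
  have "complex_of_real (nsq (I \<times> I) (wedge a b)) =
      of_real (2 * (nsq I a * nsq I b - (cmod (ip I a b))\<^sup>2))"
    unfolding ip_self[symmetric] ip_wedge
    by (simp add: ip_self complex_norm_square cnj_ip mult.commute del: of_real_power)
  then show ?thesis
    by (simp only: of_real_eq_iff)
qed

text \<open>
  Lagrange's identity above exhibits the defect in Cauchy-Schwarz as half a squared norm.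
\<close>

lemma Cauchy_Schwarz_ip: "(cmod (ip I a b))\<^sup>2 \<le> nsq I a * nsq I b"
  using nsq_nonneg[of "I \<times> I" "wedge a b"] unfolding nsq_wedge by simp

text \<open>
  Cauchy-Schwarz once more, now for the wedge products themselves. This controls the cross
  determinant of two pairs of vectors by their Gram determinants.
\<close>

lemma Cauchy_Schwarz_wedge:
  "(cmod (ip I a x * ip I b y - ip I b x * ip I a y))\<^sup>2 \<le>
     (nsq I a * nsq I b - (cmod (ip I a b))\<^sup>2) * (nsq I x * nsq I y - (cmod (ip I x y))\<^sup>2)"
    (is "(cmod ?d)\<^sup>2 \<le> ?g * ?h")
proof -
  have "(cmod (2 * ?d))\<^sup>2 \<le> (2 * ?g) * (2 * ?h)"
    using Cauchy_Schwarz_ip[of "I \<times> I" "wedge a b" "wedge x y"]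
    unfolding ip_wedge nsq_wedge .
  moreover have "(cmod (2 * ?d))\<^sup>2 = 4 * (cmod ?d)\<^sup>2"
    unfolding norm_mult power_mult_distrib by simp
  ultimately show ?thesis by linarith
qed

section \<open>The rank-one inequalities\<close>

text \<open>
  For the Gram matrices \<open>G\<close>, \<open>G'\<close> of two pairs of vectors, with diagonals \<open>p, q\<close> and
  \<open>p', q'\<close> and off-diagonal moduli \<open>s\<close>, \<open>s'\<close>, the right-hand side is the least value of
  \<open>tr (G G')\<close> over the phases of the off-diagonal entries. The bound is
  \<open>tr (G G') \<ge> 2 sqrt (det G * det G')\<close>, an instance of the arithmetic-geometric mean
  inequality for the eigenvalues of \<open>G G'\<close>.
\<close>

lemma two_det_le:
  fixes p q p' q' s s' d :: real
  assumes nonneg: "0 \<le> p" "0 \<le> q" "0 \<le> p'" "0 \<le> q'" "0 \<le> s" "0 \<le> s'"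
    and s: "s\<^sup>2 \<le> p * q" and s': "s'\<^sup>2 \<le> p' * q'"
    and d: "d\<^sup>2 \<le> (p * q - s\<^sup>2) * (p' * q' - s'\<^sup>2)"
  shows "2 * d \<le> p * p' + q * q' - 2 * (s * s')"
proof -
  define X Y where "X = sqrt (p * q)" and "Y = sqrt (p' * q')"
  have XY: "X\<^sup>2 = p * q" "Y\<^sup>2 = p' * q'" "0 \<le> X" "0 \<le> Y"
    using nonneg by (simp_all add: X_def Y_def)
  have "s \<le> X" "s' \<le> Y"
    using s s' XY nonneg by (auto intro: power2_le_imp_le)
  then have prod: "0 \<le> X * Y - s * s'"
    using nonneg by (simp add: mult_mono)
  \<comment> \<open>The reversed Cauchy-Schwarz inequality for the vectors \<open>(X, s)\<close> and \<open>(Y, s')\<close> in the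
     Lorentzian plane.\<close>
  have "(X * Y - s * s')\<^sup>2 = (X\<^sup>2 - s\<^sup>2) * (Y\<^sup>2 - s'\<^sup>2) + (X * s' - Y * s)\<^sup>2"
    by (simp add: power2_eq_square algebra_simps)
  then have "d\<^sup>2 \<le> (X * Y - s * s')\<^sup>2"
    using d unfolding XY by (smt (verit) zero_le_power2)
  then have 1: "d \<le> X * Y - s * s'"
    using prod by (rule power2_le_imp_le)
  have "(2 * (X * Y))\<^sup>2 = 4 * (p * q) * (p' * q')"
    by (simp add: power_mult_distrib XY)
  also have "\<dots> = (p * p' + q * q')\<^sup>2 - (p * p' - q * q')\<^sup>2"
    by (simp add: power2_eq_square algebra_simps)
  also have "\<dots> \<le> (p * p' + q * q')\<^sup>2"
    by simp
  finally have "2 * (X * Y) \<le> p * p' + q * q'"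
    using nonneg by (auto intro: power2_le_imp_le)
  with 1 show ?thesis by simp
qed

lemma two_mult_le_sum_squares: "2 * (s * t) \<le> s\<^sup>2 + t\<^sup>2" for s t :: real
  using sum_squares_bound[of s t] by simp

lemma rank_one_form_nonneg:
  "0 \<le> nsq I a * nsq I x + nsq I b * nsq I y
      + (cmod (ip I b x))\<^sup>2 + (cmod (ip I a y))\<^sup>2
      + 2 * Re (ip I a b * ip I y x) - 2 * Re (ip I a x * ip I y b)"
proof -
  define D where "D = ip I a x * ip I b y - ip I b x * ip I a y"
  have gram: "2 * cmod D \<le> nsq I a * nsq I x + nsq I b * nsq I y
      - 2 * (cmod (ip I a b) * cmod (ip I x y))"
    by (rule two_det_le)
      (use Cauchy_Schwarz_wedge[of I a x b y] in
        \<open>auto simp: D_def nsq_nonneg Cauchy_Schwarz_ip\<close>)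
  have cross: "- (cmod (ip I a b) * cmod (ip I x y)) \<le> Re (ip I a b * ip I y x)"
    using abs_Re_le_cmod[of "ip I a b * ip I y x"]
    by (simp add: norm_mult norm_ip_commute[of I y x])
  have "Re (ip I a x * ip I y b) \<le> cmod (ip I a x * ip I b y)"
    using complex_Re_le_cmod[of "ip I a x * ip I y b"]
    by (simp add: norm_mult norm_ip_commute[of I y b])
  also have "\<dots> = cmod (D + ip I b x * ip I a y)"
    by (simp add: D_def)
  also have "\<dots> \<le> cmod D + cmod (ip I b x) * cmod (ip I a y)"
    by (metis norm_triangle_ineq norm_mult)
  finally have "Re (ip I a x * ip I y b) \<le> cmod D + cmod (ip I b x) * cmod (ip I a y)" .
  with gram cross two_mult_le_sum_squares[of "cmod (ip I b x)" "cmod (ip I a y)"]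
  show ?thesis by linarith
qed

text \<open>
  After the partial transpose the two squared inner products alone dominate the negative term,
  so the Gram part needs only to be nonnegative: this is the determinant bound with \<open>d = 0\<close>.
\<close>

lemma rank_one_transposed_form_nonneg:
  "0 \<le> nsq I a * nsq I x + nsq I b * nsq I y
      + (cmod (ip I b x))\<^sup>2 + (cmod (ip I a y))\<^sup>2
      + 2 * Re (ip I b a * ip I y x) - 2 * Re (ip I b x * ip I y a)"
proof -
  have gram: "2 * 0 \<le> nsq I a * nsq I x + nsq I b * nsq I y
      - 2 * (cmod (ip I a b) * cmod (ip I x y))"
    by (rule two_det_le) (auto simp: nsq_nonneg Cauchy_Schwarz_ip)
  have cross: "- (cmod (ip I a b) * cmod (ip I x y)) \<le> Re (ip I b a * ip I y x)"
    using abs_Re_le_cmod[of "ip I b a * ip I y x"]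
    by (simp add: norm_mult norm_ip_commute[of I y x] norm_ip_commute[of I b a])
  have "Re (ip I b x * ip I y a) \<le> cmod (ip I b x) * cmod (ip I a y)"
    using complex_Re_le_cmod[of "ip I b x * ip I y a"]
    by (simp add: norm_mult norm_ip_commute[of I y a])
  with gram cross two_mult_le_sum_squares[of "cmod (ip I b x)" "cmod (ip I a y)"]
  show ?thesis by linarith
qed

section \<open>Positive semidefinite matrices as sums of rank-one matrices\<close>

text \<open>
  Matrices and vectors are functions here, of which only the values below \<open>m\<close> count, so that
  the induction on the size can drop the last row and column without changing carriers.
\<close>

definition hform :: "(nat \<Rightarrow> nat \<Rightarrow> complex) \<Rightarrow> nat \<Rightarrow> (nat \<Rightarrow> complex) \<Rightarrow> complex" where
  "hform h m v = (\<Sum>i<m. \<Sum>j<m. h i j * v j * cnj (v i))"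

lemma hform_Suc:
  "hform h (Suc m) v = hform h m v + v m * (\<Sum>i<m. h i m * cnj (v i))
     + cnj (v m) * (\<Sum>j<m. h m j * v j) + h m m * v m * cnj (v m)"
  unfolding hform_def by (simp add: sum.distrib sum_distrib_left algebra_simps)

lemma hform_cong:
  assumes "\<And>i j. i < m \<Longrightarrow> j < m \<Longrightarrow> h i j = h' i j" "\<And>i. i < m \<Longrightarrow> v i = v' i"
  shows "hform h m v = hform h' m v'"
  unfolding hform_def using assms by (intro sum.cong) auto

text \<open>
  The column of a vanishing diagonal entry vanishes: otherwise the form could be made negative
  on the span of two coordinate vectors. This is what lets the elimination below pass over a
  zero pivot.
\<close>

lemma zero_pivot_column:
  assumes herm: "\<And>i j. i < m \<Longrightarrow> j < m \<Longrightarrow> h j i = cnj (h i j)"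
    and psd: "\<And>v. 0 \<le> hform h m v"
    and kl: "k < m" "l < m" and zero: "h l l = 0"
  shows "h k l = 0"
proof (rule ccontr)
  assume ne: "h k l \<noteq> 0"
  then have "k \<noteq> l" using zero by auto
  define r where "r = Re (h k k)"
  \<comment> \<open>On \<open>e\<^sub>k + t e\<^sub>l\<close> the form is \<open>r + 2 Re (h k l * t)\<close>; this \<open>t\<close> makes it \<open>- 1\<close>.\<close>
  define t where "t = (- (r + 1) / (2 * (cmod (h k l))\<^sup>2)) *\<^sub>R cnj (h k l)"
  define v where "v = (\<lambda>i. if i = k then 1 else if i = l then t else 0)"
  have supp: "(\<Sum>j<m. f j) = f k + f l" if "\<And>j. j \<noteq> k \<Longrightarrow> j \<noteq> l \<Longrightarrow> f j = 0" for f :: "nat \<Rightarrow> complex"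
  proof -
    have "(\<Sum>j<m. f j) = (\<Sum>j\<in>{k, l}. f j)"
      by (rule sum.mono_neutral_right) (use kl that in auto)
    then show ?thesis using \<open>k \<noteq> l\<close> by simp
  qed
  have row: "(\<Sum>j<m. h i j * v j * cnj (v i)) = (h i k + h i l * t) * cnj (v i)" for i
    by (subst supp) (use \<open>k \<noteq> l\<close> in \<open>auto simp: v_def algebra_simps\<close>)
  have "hform h m v = h k k + h k l * t + h l k * cnj t"
    unfolding hform_def row
    by (subst supp) (use \<open>k \<noteq> l\<close> zero in \<open>auto simp: v_def algebra_simps\<close>)
  also have "h l k * cnj t = cnj (h k l * t)"
    using herm[OF kl] by simp
  finally have "Re (hform h m v) = r + 2 * Re (h k l * t)"
    by (simp add: r_def)
  also have "h k l * t = (- (r + 1) / (2 * (cmod (h k l))\<^sup>2)) *\<^sub>R (h k l * cnj (h k l))"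
    by (simp add: t_def)
  also have "\<dots> = of_real (- (r + 1) / 2)"
    using ne unfolding complex_norm_square[symmetric] scaleR_conv_of_real of_real_mult[symmetric]
    by simp
  finally have "Re (hform h m v) = - 1"
    by (simp add: field_simps)
  moreover have "0 \<le> Re (hform h m v)"
    using psd[of v] by (simp add: less_eq_complex_def)
  ultimately show False by simp
qed

text \<open>
  Cholesky elimination, working from the last index down. Subtracting the rank-one matrix built
  from the last column leaves a matrix whose last row and column are zero and whose remaining
  part, the Schur complement, is again positive semidefinite. A zero pivot requires no case
  distinction in the definitions, because then the last column is zero and division by zero
  gives zero.
\<close>

lemma gram_decomposition:
  assumes "\<And>i j. i < m \<Longrightarrow> j < m \<Longrightarrow> h j i = cnj (h i j)"
    and "\<And>v. 0 \<le> hform h m v"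
  shows "\<exists>w. \<forall>i<m. \<forall>j<m. h i j = (\<Sum>k<m. w k i * cnj (w k j))"
  using assms
proof (induction m arbitrary: h)
  case 0
  then show ?case by simp
next
  case (Suc m)
  note herm = Suc.prems(1) and psd = Suc.prems(2)
  define d where "d = Re (h m m)"
  have "hform h (Suc m) (\<lambda>i. if i = m then 1 else 0) = h m m"
    unfolding hform_Suc by (simp add: hform_def)
  with psd[of "\<lambda>i. if i = m then 1 else 0"] have d: "h m m = of_real d" "0 \<le> d"
    by (auto simp: less_eq_complex_def d_def complex_eq_iff)
  define h' where "h' = (\<lambda>i j. h i j - h i m * h m j / of_real d)"
  have "\<exists>w. \<forall>i<m. \<forall>j<m. h' i j = (\<Sum>k<m. w k i * cnj (w k j))"
  proof (rule Suc.IH)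
    fix i j assume "i < m" "j < m"
    then show "h' j i = cnj (h' i j)"
      using herm[of i j] herm[of i m] herm[of j m] by (simp add: h'_def)
  next
    fix v :: "nat \<Rightarrow> complex"
    define L where "L = (\<Sum>j<m. h m j * v j)"
    have cL: "(\<Sum>i<m. h i m * cnj (v i)) = cnj L"
      unfolding L_def cnj_sum using herm[of m] by (intro sum.cong) auto
    \<comment> \<open>The last coordinate that minimises the large form gives the form of the Schur
       complement.\<close>
    define v' where "v' = v(m := - L / of_real d)"
    have "hform h (Suc m) v' = hform h m v - L / of_real d * cnj L"
      unfolding hform_Suc d
      using hform_cong[of m h h v' v] cL
      by (cases "d = 0") (simp_all add: v'_def L_def[symmetric])
    also have "L / of_real d * cnj L = cnj L * L / of_real d"
      by simp
    also have "\<dots> = (\<Sum>i<m. \<Sum>j<m. h i m * h m j / of_real d * v j * cnj (v i))"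
      unfolding cL[symmetric]
      unfolding L_def sum_product sum_divide_distrib
      by (intro sum.cong refl) (simp add: algebra_simps)
    also have "hform h m v - \<dots> = hform h' m v"
      unfolding hform_def h'_def by (simp add: sum_subtractf algebra_simps)
    finally show "0 \<le> hform h' m v"
      using psd[of v'] by simp
  qed
  then obtain w where w: "\<And>i j. i < m \<Longrightarrow> j < m \<Longrightarrow> h' i j = (\<Sum>k<m. w k i * cnj (w k j))"
    by blast
  define u where "u = (\<lambda>k i. if k = m then h i m / of_real (sqrt d) else if i = m then 0 else w k i)"
  have col: "h i m * h m j / of_real d = u m i * cnj (u m j)" if "i < Suc m" "j < Suc m" for i j
  proof -
    have "complex_of_real (sqrt d) * of_real (sqrt d) = of_real d"
      using d(2) by (simp flip: of_real_mult)
    then show ?thesis using herm[of j m] that by (simp add: u_def)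
  qed
  have split: "h i j = h' i j + h i m * h m j / of_real d" for i j
    by (simp add: h'_def)
  have last: "h' i m = 0" "h' m i = 0" if "i < Suc m" for i
  proof -
    have "h i m = 0" if "d = 0"
      using zero_pivot_column[of "Suc m" h i m, OF herm psd] \<open>i < Suc m\<close> d that by simp
    moreover from this have "h m i = 0" if "d = 0"
      using herm[of i m] \<open>i < Suc m\<close> that by simp
    ultimately show "h' i m = 0" "h' m i = 0"
      by (cases "d = 0"; simp add: h'_def d)+
  qed
  have "h i j = (\<Sum>k<Suc m. u k i * cnj (u k j))" if ij: "i < Suc m" "j < Suc m" for i j
  proof -
    have "h' i j = (\<Sum>k<m. u k i * cnj (u k j))"
    proof (cases "i = m \<or> j = m")
      case True
      then show ?thesis using last ij by (auto simp: u_def)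
    next
      case False
      then show ?thesis using w[of i j] ij by (simp add: u_def)
    qed
    then show ?thesis using split[of i j] col[OF ij] by simp
  qed
  then show ?case by blast
qed

lemma complex_of_real_nonneg: "0 \<le> r \<Longrightarrow> 0 \<le> complex_of_real r"
  by (simp add: less_eq_complex_def)

lemma mat_adjoint_carrier: "A \<in> carrier_mat n n \<Longrightarrow> mat_adjoint A \<in> carrier_mat n n"
  for A :: "complex mat"
  unfolding mat_adjoint_def by auto

lemma mat_adjoint_index:
  "A \<in> carrier_mat n n \<Longrightarrow> i < n \<Longrightarrow> j < n \<Longrightarrow> mat_adjoint A $$ (i, j) = cnj (A $$ (j, i))"
  for A :: "complex mat"
  unfolding mat_adjoint_def by (simp add: mat_of_rows_def)

lemma mat_adjoint_eqI:
  fixes A :: "complex mat"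
  assumes "A \<in> carrier_mat n n" "B \<in> carrier_mat n n"
    and "\<And>i j. i < n \<Longrightarrow> j < n \<Longrightarrow> B $$ (i, j) = cnj (A $$ (j, i))"
  shows "mat_adjoint A = B"
  using assms mat_adjoint_carrier[OF assms(1)]
  by (intro eq_matI) (auto simp: mat_adjoint_index)

lemma sesquilinear_eq_sum:
  fixes M :: "complex mat"
  assumes "M \<in> carrier_mat n n" "x \<in> carrier_vec n" "y \<in> carrier_vec n"
  shows "(M *\<^sub>v y) \<bullet>c x = (\<Sum>i<n. \<Sum>j<n. M $$ (i, j) * y $ j * cnj (x $ i))"
  using assms
  by (auto simp: scalar_prod_def atLeast0LessThan sum_distrib_right intro!: sum.cong)

lemma positive_semidefinite_gram:
  assumes H: "H \<in> carrier_mat m m" and psd: "positive_semidefinite H"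
  shows "\<exists>w. \<forall>i<m. \<forall>j<m. H $$ (i, j) = (\<Sum>k<m. w k i * cnj (w k j))"
proof (rule gram_decomposition[of m "\<lambda>i j. H $$ (i, j)"])
  fix i j assume "i < m" "j < m"
  then show "H $$ (j, i) = cnj (H $$ (i, j))"
    using mat_adjoint_index[OF H, of j i] psd by (simp add: positive_semidefinite_def)
next
  fix v :: "nat \<Rightarrow> complex"
  have "hform (\<lambda>i j. H $$ (i, j)) m v = (H *\<^sub>v vec m v) \<bullet>c vec m v"
    unfolding hform_def sesquilinear_eq_sum[OF H vec_carrier vec_carrier]
    by (intro sum.cong refl) simp
  moreover have "0 \<le> (H *\<^sub>v vec m v) \<bullet>c vec m v"
    using psd H unfolding positive_semidefinite_def by auto
  ultimately show "0 \<le> hform (\<lambda>i j. H $$ (i, j)) m v" by simp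
qed

section \<open>From rank-one inequalities to block matrices\<close>

lemma sesquilinear_sum_rank_one:
  fixes M :: "complex mat"
  assumes "M \<in> carrier_mat n n" "x \<in> carrier_vec n" "y \<in> carrier_vec n"
    and "\<And>i j. i < n \<Longrightarrow> j < n \<Longrightarrow> M $$ (i, j) = (\<Sum>k\<in>K. u k i * cnj (v k j))"
  shows "(M *\<^sub>v y) \<bullet>c x = (\<Sum>k\<in>K. ip {..<n} (u k) (($) x) * ip {..<n} (($) y) (v k))"
proof -
  have "(M *\<^sub>v y) \<bullet>c x =
      (\<Sum>i<n. \<Sum>j<n. \<Sum>k\<in>K. u k i * cnj (x $ i) * (y $ j * cnj (v k j)))"
    unfolding sesquilinear_eq_sum[OF assms(1-3)]
    by (intro sum.cong refl) (simp add: assms(4) sum_distrib_left sum_distrib_right algebra_simps)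
  also have "\<dots> = (\<Sum>i<n. \<Sum>k\<in>K. \<Sum>j<n. u k i * cnj (x $ i) * (y $ j * cnj (v k j)))"
    by (intro sum.cong refl sum.swap)
  also have "\<dots> = (\<Sum>k\<in>K. \<Sum>i<n. \<Sum>j<n. u k i * cnj (x $ i) * (y $ j * cnj (v k j)))"
    by (rule sum.swap)
  finally show ?thesis unfolding ip_def sum_product .
qed

lemma mat_trace_sum_rank_one:
  assumes "M \<in> carrier_mat n n"
    and "\<And>i j. i < n \<Longrightarrow> j < n \<Longrightarrow> M $$ (i, j) = (\<Sum>k\<in>K. u k i * cnj (v k j))"
  shows "mat_trace M = (\<Sum>k\<in>K. ip {..<n} (u k) (v k))"
proof -
  have "mat_trace M = (\<Sum>i<n. \<Sum>k\<in>K. u k i * cnj (v k i))"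
    using assms unfolding mat_trace_def by auto
  then show ?thesis unfolding ip_def by (simp add: sum.swap[of _ _ K])
qed

lemma sesquilinear_shift:
  fixes M :: "complex mat"
  assumes "M \<in> carrier_mat n n" "x \<in> carrier_vec n" "y \<in> carrier_vec n"
  shows "((c \<cdot>\<^sub>m 1\<^sub>m n + M) *\<^sub>v y) \<bullet>c x = c * ip {..<n} (($) y) (($) x) + (M *\<^sub>v y) \<bullet>c x"
    and "((c \<cdot>\<^sub>m 1\<^sub>m n - M) *\<^sub>v y) \<bullet>c x = c * ip {..<n} (($) y) (($) x) - (M *\<^sub>v y) \<bullet>c x"
proof -
  have delta: "(\<Sum>i<n. \<Sum>j<n. (c * (if i = j then 1 else 0)) * y $ j * cnj (x $ i))
      = c * ip {..<n} (($) y) (($) x)"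
  proof -
    have "(\<Sum>i<n. \<Sum>j<n. (c * (if i = j then 1 else 0)) * y $ j * cnj (x $ i))
        = (\<Sum>i<n. \<Sum>j<n. if i = j then c * y $ j * cnj (x $ i) else 0)"
      by (intro sum.cong refl) simp
    then show ?thesis
      by (simp add: ip_def sum_distrib_left mult.assoc)
  qed
  have car: "c \<cdot>\<^sub>m 1\<^sub>m n + M \<in> carrier_mat n n" "c \<cdot>\<^sub>m 1\<^sub>m n - M \<in> carrier_mat n n"
    using assms by auto
  show "((c \<cdot>\<^sub>m 1\<^sub>m n + M) *\<^sub>v y) \<bullet>c x = c * ip {..<n} (($) y) (($) x) + (M *\<^sub>v y) \<bullet>c x"
    unfolding sesquilinear_eq_sum[OF car(1) assms(2,3)] sesquilinear_eq_sum[OF assms]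
      delta[symmetric] sum.distrib[symmetric]
    using assms by (intro sum.cong refl) (simp add: algebra_simps)
  show "((c \<cdot>\<^sub>m 1\<^sub>m n - M) *\<^sub>v y) \<bullet>c x = c * ip {..<n} (($) y) (($) x) - (M *\<^sub>v y) \<bullet>c x"
    unfolding sesquilinear_eq_sum[OF car(2) assms(2,3)] sesquilinear_eq_sum[OF assms]
      delta[symmetric] sum_subtractf[symmetric]
    using assms by (intro sum.cong refl) (simp add: algebra_simps)
qed

lemma positive_semidefinite_blockI:
  fixes P Q R :: "complex mat"
  assumes P: "P \<in> carrier_mat n n" and Q: "Q \<in> carrier_mat n n" and R: "R \<in> carrier_mat n n"
    and herm: "mat_adjoint P = P" "mat_adjoint R = R"
    and nonneg: "\<And>x y. x \<in> carrier_vec n \<Longrightarrow> y \<in> carrier_vec n \<Longrightarrow>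
      0 \<le> (P *\<^sub>v x) \<bullet>c x + (Q *\<^sub>v y) \<bullet>c x + (mat_adjoint Q *\<^sub>v x) \<bullet>c y + (R *\<^sub>v y) \<bullet>c y"
  shows "positive_semidefinite (four_block_mat P Q (mat_adjoint Q) R)" (is "positive_semidefinite ?M")
proof -
  note Q' = mat_adjoint_carrier[OF Q]
  have M: "?M \<in> carrier_mat (n + n) (n + n)"
    using P R by simp
  have "mat_adjoint ?M = ?M"
  proof (rule mat_adjoint_eqI[OF M M])
    fix i j assume ij: "i < n + n" "j < n + n"
    have P': "P $$ (i, j) = cnj (P $$ (j, i))" if "i < n" "j < n" for i j
      using mat_adjoint_index[OF P that] herm(1) by simp
    have R': "R $$ (i, j) = cnj (R $$ (j, i))" if "i < n" "j < n" for i j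
      using mat_adjoint_index[OF R that] herm(2) by simp
    show "?M $$ (i, j) = cnj (?M $$ (j, i))"
      using ij P Q R Q' by (auto simp: mat_adjoint_index[OF Q] intro: P' R')
  qed
  moreover have "0 \<le> (?M *\<^sub>v v) \<bullet>c v" if "v \<in> carrier_vec (n + n)" for v
  proof -
    define x y where "x = vec_first v n" and "y = vec_last v n"
    have x: "x \<in> carrier_vec n" and y: "y \<in> carrier_vec n" and v: "v = x @\<^sub>v y"
      using that by (simp_all add: x_def y_def)
    have "conjugate (x @\<^sub>v y) = conjugate x @\<^sub>v conjugate y"
      using x y by (intro eq_vecI) auto
    then have "(?M *\<^sub>v v) \<bullet>c v = (P *\<^sub>v x + Q *\<^sub>v y) \<bullet>c x + (mat_adjoint Q *\<^sub>v x + R *\<^sub>v y) \<bullet>c y"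
      unfolding v four_block_mat_mult_vec[OF P Q Q' R x y]
      using P Q R Q' x y by (simp add: scalar_prod_append[of _ n _ n])
    also have "\<dots> = (P *\<^sub>v x) \<bullet>c x + (Q *\<^sub>v y) \<bullet>c x + (mat_adjoint Q *\<^sub>v x) \<bullet>c y + (R *\<^sub>v y) \<bullet>c y"
      using P Q R Q' x y by (simp add: add_scalar_prod_distrib[of _ n])
    finally show ?thesis using nonneg[OF x y] by simp
  qed
  ultimately show ?thesis
    unfolding positive_semidefinite_def using M P R by auto
qed

text \<open>
  Both matrices to be handled have the same shape, with \<open>S\<close> standing for \<open>B\<close> or for its
  adjoint. Their quadratic forms are additive over the rank-one decomposition, so positivity may
  be checked for each index \<open>k\<close> separately. The hypothesis \<open>form\<close> is written in the form in
  which the rank-one inequalities are proved, with \<open>(u, v)\<close> being \<open>(a, b)\<close> or \<open>(b, a)\<close>.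
\<close>

lemma positive_semidefinite_trace_shifted_block:
  fixes A S C :: "complex mat"
  assumes A: "A \<in> carrier_mat n n" and S: "S \<in> carrier_mat n n" and C: "C \<in> carrier_mat n n"
    and A_eq: "\<And>i j. i < n \<Longrightarrow> j < n \<Longrightarrow> A $$ (i, j) = (\<Sum>k\<in>K. a k i * cnj (a k j))"
    and S_eq: "\<And>i j. i < n \<Longrightarrow> j < n \<Longrightarrow> S $$ (i, j) = (\<Sum>k\<in>K. u k i * cnj (v k j))"
    and C_eq: "\<And>i j. i < n \<Longrightarrow> j < n \<Longrightarrow> C $$ (i, j) = (\<Sum>k\<in>K. b k i * cnj (b k j))"
    and form: "\<And>k x y. 0 \<le> nsq {..<n} (a k) * nsq {..<n} x + nsq {..<n} (b k) * nsq {..<n} y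
        + (cmod (ip {..<n} (b k) x))\<^sup>2 + (cmod (ip {..<n} (a k) y))\<^sup>2
        + 2 * Re (ip {..<n} (u k) (v k) * ip {..<n} y x)
        - 2 * Re (ip {..<n} (u k) x * ip {..<n} y (v k))"
  shows "positive_semidefinite (four_block_mat
           (mat_trace A \<cdot>\<^sub>m 1\<^sub>m n + C) (mat_trace S \<cdot>\<^sub>m 1\<^sub>m n - S)
           (mat_trace (mat_adjoint S) \<cdot>\<^sub>m 1\<^sub>m n - mat_adjoint S) (mat_trace C \<cdot>\<^sub>m 1\<^sub>m n + A))"
proof -
  note S' = mat_adjoint_carrier[OF S]
  have S'_eq: "mat_adjoint S $$ (i, j) = (\<Sum>k\<in>K. v k i * cnj (u k j))" if "i < n" "j < n" for i j
    using that by (simp add: mat_adjoint_index[OF S] S_eq mult.commute)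
  note tr = mat_trace_sum_rank_one[OF A A_eq] mat_trace_sum_rank_one[OF S S_eq]
    mat_trace_sum_rank_one[OF S' S'_eq] mat_trace_sum_rank_one[OF C C_eq]
  let ?P = "mat_trace A \<cdot>\<^sub>m 1\<^sub>m n + C" and ?Q = "mat_trace S \<cdot>\<^sub>m 1\<^sub>m n - S"
    and ?Q' = "mat_trace (mat_adjoint S) \<cdot>\<^sub>m 1\<^sub>m n - mat_adjoint S"
    and ?R = "mat_trace C \<cdot>\<^sub>m 1\<^sub>m n + A"
  have car: "?P \<in> carrier_mat n n" "?Q \<in> carrier_mat n n" "?Q' \<in> carrier_mat n n" "?R \<in> carrier_mat n n"
    using A S C S' by auto
  have P: "mat_adjoint ?P = ?P"
    by (rule mat_adjoint_eqI[OF car(1) car(1)])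
      (use A C in \<open>auto simp: tr C_eq cnj_ip mult.commute\<close>)
  have R: "mat_adjoint ?R = ?R"
    by (rule mat_adjoint_eqI[OF car(4) car(4)])
      (use A C in \<open>auto simp: tr A_eq cnj_ip mult.commute\<close>)
  have Q: "mat_adjoint ?Q = ?Q'"
    by (rule mat_adjoint_eqI[OF car(2) car(3)])
      (use S S' in \<open>auto simp: tr S_eq S'_eq cnj_ip mult.commute\<close>)
  have real_form: "complex_of_real (p + 2 * Re z - 2 * Re z') = of_real p + z + cnj z - z' - cnj z'"
    for p z z'
    by (simp add: complex_eq_iff)
  have "positive_semidefinite (four_block_mat ?P ?Q (mat_adjoint ?Q) ?R)"
  proof (rule positive_semidefinite_blockI[OF car(1,2,4) P R])
    fix x y :: "complex vec" assume x: "x \<in> carrier_vec n" and y: "y \<in> carrier_vec n"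
    let ?ip = "ip {..<n}" and ?N = "nsq {..<n}" and ?x = "($) x" and ?y = "($) y"
    have "(?P *\<^sub>v x) \<bullet>c x + (?Q *\<^sub>v y) \<bullet>c x + (?Q' *\<^sub>v x) \<bullet>c y + (?R *\<^sub>v y) \<bullet>c y =
      (\<Sum>k\<in>K. ?ip (a k) (a k) * ?ip ?x ?x + ?ip (b k) ?x * ?ip ?x (b k)
        + (?ip (u k) (v k) * ?ip ?y ?x - ?ip (u k) ?x * ?ip ?y (v k))
        + (?ip (v k) (u k) * ?ip ?x ?y - ?ip (v k) ?y * ?ip ?x (u k))
        + (?ip (b k) (b k) * ?ip ?y ?y + ?ip (a k) ?y * ?ip ?y (a k)))"
      using A S C S' x y
      by (simp add: sesquilinear_shift tr sesquilinear_sum_rank_one[OF A _ _ A_eq]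
          sesquilinear_sum_rank_one[OF S _ _ S_eq] sesquilinear_sum_rank_one[OF C _ _ C_eq]
          sesquilinear_sum_rank_one[OF S' _ _ S'_eq] sum.distrib sum_subtractf sum_distrib_right)
    also have "\<dots> = of_real (\<Sum>k\<in>K. (?N (a k) * ?N ?x + ?N (b k) * ?N ?y
        + (cmod (?ip (b k) ?x))\<^sup>2 + (cmod (?ip (a k) ?y))\<^sup>2)
        + 2 * Re (?ip (u k) (v k) * ?ip ?y ?x) - 2 * Re (?ip (u k) ?x * ?ip ?y (v k)))"
      unfolding of_real_sum real_form
      by (intro sum.cong refl)
        (simp add: ip_self complex_norm_square cnj_ip algebra_simps del: of_real_power)
    also have "0 \<le> \<dots>"
      by (intro complex_of_real_nonneg sum_nonneg form)
    finally show "0 \<le> (?P *\<^sub>v x) \<bullet>c x + (?Q *\<^sub>v y) \<bullet>c x + (mat_adjoint ?Q *\<^sub>v x) \<bullet>c y + (?R *\<^sub>v y) \<bullet>c y"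
      unfolding Q .
  qed
  then show ?thesis unfolding Q .
qed

theorem theorem6p3:
  fixes n :: nat and A B C :: "complex mat"
  assumes "n \<ge> 1"
    and "A \<in> carrier_mat n n" and "B \<in> carrier_mat n n" and "C \<in> carrier_mat n n"
    and "positive_semidefinite (four_block_mat A B (mat_adjoint B) C)"
  shows "PPT n (four_block_mat
           (mat_trace A \<cdot>\<^sub>m 1\<^sub>m n + C)                (mat_trace B \<cdot>\<^sub>m 1\<^sub>m n - B)
           (mat_trace (mat_adjoint B) \<cdot>\<^sub>m 1\<^sub>m n - mat_adjoint B)  (mat_trace C \<cdot>\<^sub>m 1\<^sub>m n + A))"
proof -
  note A = assms(2) and B = assms(3) and C = assms(4)
  note B' = mat_adjoint_carrier[OF B]
  have B'': "mat_adjoint (mat_adjoint B) = B"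
    by (rule mat_adjoint_eqI[OF B' B]) (simp add: mat_adjoint_index[OF B])
  let ?H = "four_block_mat A B (mat_adjoint B) C"
  have "?H \<in> carrier_mat (n + n) (n + n)"
    using A C by simp
  from positive_semidefinite_gram[OF this assms(5)] obtain w where
    w: "\<And>i j. i < n + n \<Longrightarrow> j < n + n \<Longrightarrow> ?H $$ (i, j) = (\<Sum>k<n + n. w k i * cnj (w k j))"
    by blast
  define b where "b = (\<lambda>k i. w k (n + i))"
  have A_eq: "A $$ (i, j) = (\<Sum>k<n + n. w k i * cnj (w k j))"
    and B_eq: "B $$ (i, j) = (\<Sum>k<n + n. w k i * cnj (b k j))"
    and C_eq: "C $$ (i, j) = (\<Sum>k<n + n. b k i * cnj (b k j))" if "i < n" "j < n" for i j
    using w[of i j] w[of i "n + j"] w[of "n + i" "n + j"] that A B C B'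
    by (simp_all add: b_def)
  have B'_eq: "mat_adjoint B $$ (i, j) = (\<Sum>k<n + n. b k i * cnj (w k j))" if "i < n" "j < n" for i j
    using that by (simp add: mat_adjoint_index[OF B] B_eq mult.commute)
  let ?P = "mat_trace A \<cdot>\<^sub>m 1\<^sub>m n + C" and ?Q = "mat_trace B \<cdot>\<^sub>m 1\<^sub>m n - B"
    and ?Q' = "mat_trace (mat_adjoint B) \<cdot>\<^sub>m 1\<^sub>m n - mat_adjoint B"
    and ?R = "mat_trace C \<cdot>\<^sub>m 1\<^sub>m n + A"
  have car: "?P \<in> carrier_mat n n" "?Q \<in> carrier_mat n n" "?Q' \<in> carrier_mat n n" "?R \<in> carrier_mat n n"
    using A B C B' by auto
  have "positive_semidefinite (four_block_mat ?P ?Q ?Q' ?R)"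
    by (rule positive_semidefinite_trace_shifted_block[OF A B C A_eq B_eq C_eq rank_one_form_nonneg])
  moreover have "positive_semidefinite (four_block_mat ?P ?Q' ?Q ?R)"
    using positive_semidefinite_trace_shifted_block
      [OF A B' C A_eq B'_eq C_eq rank_one_transposed_form_nonneg]
    unfolding B'' .
  ultimately show ?thesis
    unfolding PPT_def partial_transpose_four_block_mat[OF car]
    using car by (auto simp: mult_2)
qed

end
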